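(* Let $\alpha,\delta\in(0,1)$. Consider any online model $\mathbf P$ for which the null $p$-values are conditionally super-uniform, i.e. $\mathbf P(p_k\le x\mid\mathcal G_{k-1})\le x$ for all $x\in[0,1]$, $k\in\mathcal H_0$, and the LORD procedure at level $\alpha$, which rejects $R(k)$ nulls up to time $k$. Define, for $k\ge1$, $$\overline{\mathrm{FDP}}^{\mathrm{Freed}}_{\alpha,k}=1\wedge\left(\alpha+\frac{\Delta(\alpha(1\vee R(k)))}{1\vee R(k)}\right),\qquad \overline{\mathrm{FDP}}^{\mathrm{KR\text{-}U}}_{\alpha,k}=1\wedge\min_{a\ge1}\left\{\frac{\log(1/\delta_a)}{a\log(1+\log(1/\delta_a)/a)}\left(\alpha+\frac a{1\vee R(k)}\right)\right\}$$ (minimum over integers $a$). If $1/R(k)=o_P(1)$ as $k\to\infty$, then both envelopes are LORD $m$-consistent, that is, for $\overline{\mathrm{FDP}}_{\alpha,k}$ equal to either $\overline{\mathrm{FDP}}^{\mathrm{Freed}}_{\alpha,k}$ or $\overline{\mathrm{FDP}}^{\mathrm{KR\text{-}U}}_{\alpha,k}$: for all $\epsilon>0$, $\lim_{k\to\infty}\mathbf P\bigl(\overline{\mathrm{FDP}}_{\alpha,k}-\alpha\ge\epsilon\bigr)=0$.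
   Context: Online setting: $p_1,p_2,\dots$ is an infinite sequence of $[0,1]$-valued $p$-values for null hypotheses $H_1,H_2,\dots$, with set of true null indices $\mathcal H_0$. An online procedure is given by critical values $(\alpha_k)_{k\ge1}$, rejecting $H_k$ if $p_k\le\alpha_k$, with $\alpha_{k+1}$ measurable with respect to $\mathcal G_k=\sigma(\mathbf 1\{p_i\le\alpha_i\},i\le k)$. $R(k)=\sum_{i=1}^k\mathbf 1\{p_i\le\alpha_i\}$. The LORD procedure at level $\alpha$ is $\alpha_k=W_0\gamma_k+(\alpha-W_0)\gamma_{k-\tau_1}+\alpha\sum_{j\ge2}\gamma_{k-\tau_j}$, where $W_0\in[0,\alpha]$, $\tau_j$ is the first time with $j$ rejections ($+\infty$ if it never occurs), and $(\gamma_k)$ is a nonnegative sequence with $\sum_{k\ge1}\gamma_k\le1$ and $\gamma_k=0$ for $k\le0$. Notation: $\kappa=\pi^2/6$, $\delta_a=\delta/(\kappa a^2)$, $\Delta(u)=2\sqrt{\varepsilon_u}\sqrt{u\vee1}+\frac12\varepsilon_u$ with $\varepsilon_u=\log((1+\kappa)/\delta)+2\log(1+\log_2(u\vee1))$. $o_P(1)$ is convergence to $0$ in probability (with $1/0=+\infty$). *)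

theory Defs
  imports "HOL-Probability.Probability"
begin

section \<open>Online multiple testing\<close>

text \<open>
  Time is indexed by \<open>k \<ge> 1\<close>; the values of \<open>p\<close> and \<open>c\<close> at index 0 are never used.
  Throughout, \<open>p\<close> is the sequence of p-values and \<open>c\<close> the sequence of critical values, both random.
\<close>

definition rejects :: "(nat \<Rightarrow> 'a \<Rightarrow> real) \<Rightarrow> (nat \<Rightarrow> 'a \<Rightarrow> real) \<Rightarrow> nat \<Rightarrow> 'a \<Rightarrow> bool" where
  "rejects p c k \<omega> \<longleftrightarrow> p k \<omega> \<le> c k \<omega>"

definition num_rejections ::
  "(nat \<Rightarrow> 'a \<Rightarrow> real) \<Rightarrow> (nat \<Rightarrow> 'a \<Rightarrow> real) \<Rightarrow> nat \<Rightarrow> 'a \<Rightarrow> nat" where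
  "num_rejections p c k \<omega> = (\<Sum>i=1..k. of_bool (rejects p c i \<omega>))"

definition rejection_algebra ::
  "'a measure \<Rightarrow> (nat \<Rightarrow> 'a \<Rightarrow> real) \<Rightarrow> (nat \<Rightarrow> 'a \<Rightarrow> real) \<Rightarrow> nat \<Rightarrow> 'a measure" where
  "rejection_algebra M p c k =
     sigma (space M)
       {(\<lambda>\<omega>. of_bool (rejects p c i \<omega>) :: real) -` B \<inter> space M | i B. i \<in> {1..k} \<and> B \<in> sets borel}"

definition online_procedure ::
  "'a measure \<Rightarrow> (nat \<Rightarrow> 'a \<Rightarrow> real) \<Rightarrow> (nat \<Rightarrow> 'a \<Rightarrow> real) \<Rightarrow> bool" where
  "online_procedure M p c \<longleftrightarrow> (\<forall>k. c (Suc k) \<in> borel_measurable (rejection_algebra M p c k))"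

definition cond_super_uniform ::
  "'a measure \<Rightarrow> (nat \<Rightarrow> 'a \<Rightarrow> real) \<Rightarrow> (nat \<Rightarrow> 'a \<Rightarrow> real) \<Rightarrow> nat set \<Rightarrow> bool" where
  "cond_super_uniform M p c H0 \<longleftrightarrow>
     (\<forall>k\<in>H0. \<forall>x\<in>{0..1}. AE \<omega> in M.
        real_cond_exp M (rejection_algebra M p c (k - 1)) (indicator {\<omega> \<in> space M. p k \<omega> \<le> x}) \<omega> \<le> x)"

section \<open>The LORD procedure\<close>

text \<open>The infimum in \<^typ>\<open>enat\<close> is \<open>\<infinity>\<close> when fewer than \<open>j\<close> rejections ever occur.\<close>

definition rejection_time ::
  "(nat \<Rightarrow> 'a \<Rightarrow> real) \<Rightarrow> (nat \<Rightarrow> 'a \<Rightarrow> real) \<Rightarrow> nat \<Rightarrow> 'a \<Rightarrow> enat" where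
  "rejection_time p c j \<omega> = Inf (enat ` {k. 1 \<le> k \<and> j \<le> num_rejections p c k \<omega>})"

text \<open>\<open>lag \<gamma> k t\<close> is \<open>\<gamma>\<close> at \<open>k - t\<close>, where \<open>k - \<infinity> = -\<infinity>\<close> and \<open>\<gamma>\<close> vanishes there.\<close>

definition lag :: "(int \<Rightarrow> real) \<Rightarrow> nat \<Rightarrow> enat \<Rightarrow> real" where
  "lag \<gamma> k t = (case t of enat n \<Rightarrow> \<gamma> (int k - int n) | \<infinity> \<Rightarrow> 0)"

definition spending_sequence :: "(int \<Rightarrow> real) \<Rightarrow> bool" where
  "spending_sequence \<gamma> \<longleftrightarrow>
     (\<forall>k. 0 \<le> \<gamma> k) \<and> (\<forall>k\<le>0. \<gamma> k = 0) \<and> \<gamma> summable_on {1..} \<and> (\<Sum>\<^sub>\<infinity>k\<in>{1..}. \<gamma> k) \<le> 1"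

text \<open>
  The defining equation is a recursion for \<open>c\<close>: only rejection times \<open>\<tau>\<^sub>j < k\<close> contribute to \<open>c k\<close>,
  and these are determined by \<open>c 1, \<dots>, c (k - 1)\<close> (see \<open>LORD_procedure_exists\<close> below).
\<close>

definition LORD_procedure ::
  "'a measure \<Rightarrow> (nat \<Rightarrow> 'a \<Rightarrow> real) \<Rightarrow> real \<Rightarrow> real \<Rightarrow> (int \<Rightarrow> real) \<Rightarrow> (nat \<Rightarrow> 'a \<Rightarrow> real) \<Rightarrow> bool" where
  "LORD_procedure M p \<alpha> W0 \<gamma> c \<longleftrightarrow>
     (\<forall>k\<ge>1. \<forall>\<omega>\<in>space M.
        c k \<omega> = W0 * \<gamma> (int k) + (\<alpha> - W0) * lag \<gamma> k (rejection_time p c 1 \<omega>)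
              + \<alpha> * (\<Sum>\<^sub>\<infinity>j\<in>{2..}. lag \<gamma> k (rejection_time p c j \<omega>)))"

section \<open>False discovery proportion envelopes\<close>

definition kappa :: real where
  "kappa = pi\<^sup>2 / 6"

definition delta_at :: "real \<Rightarrow> nat \<Rightarrow> real" where
  "delta_at \<delta> a = \<delta> / (kappa * (real a)\<^sup>2)"

definition eps_at :: "real \<Rightarrow> real \<Rightarrow> real" where
  "eps_at \<delta> u = ln ((1 + kappa) / \<delta>) + 2 * ln (1 + log 2 (max u 1))"

definition Delta :: "real \<Rightarrow> real \<Rightarrow> real" where
  "Delta \<delta> u = 2 * sqrt (eps_at \<delta> u) * sqrt (max u 1) + eps_at \<delta> u / 2"

definition FDP_Freed :: "real \<Rightarrow> real \<Rightarrow> nat \<Rightarrow> real" where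
  "FDP_Freed \<delta> \<alpha> r = min 1 (\<alpha> + Delta \<delta> (\<alpha> * real (max 1 r)) / real (max 1 r))"

definition KR_U_term :: "real \<Rightarrow> real \<Rightarrow> nat \<Rightarrow> nat \<Rightarrow> real" where
  "KR_U_term \<delta> \<alpha> r a =
     ln (1 / delta_at \<delta> a) / (real a * ln (1 + ln (1 / delta_at \<delta> a) / real a))
       * (\<alpha> + real a / real (max 1 r))"

text \<open>The infimum is a minimum, see \<open>KR_U_min_attained\<close> below.\<close>

definition FDP_KR_U :: "real \<Rightarrow> real \<Rightarrow> nat \<Rightarrow> real" where
  "FDP_KR_U \<delta> \<alpha> r = min 1 (INF a\<in>{1..}. KR_U_term \<delta> \<alpha> r a)"

section \<open>Convergence in probability and consistency\<close>

text \<open>Values in \<^typ>\<open>ennreal\<close>, so that \<open>1 / 0 = \<infinity>\<close>.\<close>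

definition o_P_one :: "'a measure \<Rightarrow> (nat \<Rightarrow> 'a \<Rightarrow> ennreal) \<Rightarrow> bool" where
  "o_P_one M X \<longleftrightarrow>
     (\<forall>\<eta>>0. (\<lambda>k. measure M {\<omega> \<in> space M. X k \<omega> > ennreal \<eta>}) \<longlonglongrightarrow> 0)"

definition m_consistent :: "'a measure \<Rightarrow> real \<Rightarrow> (nat \<Rightarrow> 'a \<Rightarrow> real) \<Rightarrow> bool" where
  "m_consistent M \<alpha> F \<longleftrightarrow>
     (\<forall>\<epsilon>>0. (\<lambda>k. measure M {\<omega> \<in> space M. F k \<omega> - \<alpha> \<ge> \<epsilon>}) \<longlonglongrightarrow> 0)"

section \<open>Well-definedness\<close>

lemma num_rejections_cong:
  assumes "\<And>i. 1 \<le> i \<Longrightarrow> i \<le> k \<Longrightarrow> rejects p c i \<omega> = rejects p c' i \<omega>'"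
  shows "num_rejections p c k \<omega> = num_rejections p c' k \<omega>'"
  unfolding num_rejections_def using assms by (intro sum.cong) auto

lemma rejection_time_eq_iff:
  "rejection_time p c j \<omega> = enat n \<longleftrightarrow>
     1 \<le> n \<and> j \<le> num_rejections p c n \<omega> \<and> (\<forall>i. 1 \<le> i \<longrightarrow> i < n \<longrightarrow> \<not> j \<le> num_rejections p c i \<omega>)"
  (is "?l \<longleftrightarrow> ?r")
proof
  let ?S = "enat ` {k. 1 \<le> k \<and> j \<le> num_rejections p c k \<omega>}"
  assume l: ?l
  then have "?S \<noteq> {}"
    unfolding rejection_time_def by (intro notI) (simp add: Inf_enat_def)
  then obtain x where "x \<in> ?S" by blast
  then have "Inf ?S \<in> ?S"
    by (rule wellorder_InfI)
  with l have 1: "enat n \<in> ?S"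
    by (simp add: rejection_time_def)
  have "enat n \<le> enat i" if "1 \<le> i" "j \<le> num_rejections p c i \<omega>" for i
    using l that unfolding rejection_time_def by (metis (mono_tags, lifting) Inf_lower imageI mem_Collect_eq)
  with 1 show ?r by fastforce
next
  assume r: ?r
  show ?l unfolding rejection_time_def
  proof (rule antisym)
    show "Inf (enat ` {k. 1 \<le> k \<and> j \<le> num_rejections p c k \<omega>}) \<le> enat n"
      using r by (intro Inf_lower) auto
    show "enat n \<le> Inf (enat ` {k. 1 \<le> k \<and> j \<le> num_rejections p c k \<omega>})"
      using r by (intro Inf_greatest) (auto simp: not_less[symmetric])
  qed
qed

lemma lag_rejection_time_cong:
  assumes "spending_sequence \<gamma>"
    and rej: "\<And>i. 1 \<le> i \<Longrightarrow> i < k \<Longrightarrow> rejects p c i \<omega> = rejects p c' i \<omega>'"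
  shows "lag \<gamma> k (rejection_time p c j \<omega>) = lag \<gamma> k (rejection_time p c' j \<omega>')"
proof -
  have num: "num_rejections p c i \<omega> = num_rejections p c' i \<omega>'" if "i < k" for i
    using that rej by (intro num_rejections_cong) auto
  have "rejection_time p c j \<omega> = enat n \<longleftrightarrow> rejection_time p c' j \<omega>' = enat n" if "n < k" for n
    unfolding rejection_time_eq_iff using num that by auto
  moreover have "\<gamma> (int k - int n) = 0" if "\<not> n < k" for n
    using assms(1) that by (auto simp: spending_sequence_def)
  moreover have "lag \<gamma> k t = lag \<gamma> k t'"
    if eq: "\<And>n. n < k \<Longrightarrow> t = enat n \<longleftrightarrow> t' = enat n"
      and z: "\<And>n. \<not> n < k \<Longrightarrow> \<gamma> (int k - int n) = 0" for t t'
  proof (cases "\<exists>n<k. t = enat n")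
    case True
    with eq show ?thesis by auto
  next
    case False
    then have "lag \<gamma> k t = 0" using z by (cases t) (auto simp: lag_def)
    moreover have "lag \<gamma> k t' = 0" using z eq False by (cases t') (auto simp: lag_def)
    ultimately show ?thesis by simp
  qed
  ultimately show ?thesis by blast
qed

lemma LORD_procedure_exists:
  assumes "spending_sequence \<gamma>"
  shows "\<exists>c. LORD_procedure M p \<alpha> W0 \<gamma> c"
proof -
  define F where "F = (\<lambda>c k \<omega>.
      W0 * \<gamma> (int k) + (\<alpha> - W0) * lag \<gamma> k (rejection_time p c 1 \<omega>)
              + \<alpha> * (\<Sum>\<^sub>\<infinity>j\<in>{2..}. lag \<gamma> k (rejection_time p c j \<omega>)))"
  have "F f k = F g k" if "\<forall>i<k. f i = g i" for f g k
  proof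
    fix \<omega>
    have "lag \<gamma> k (rejection_time p f j \<omega>) = lag \<gamma> k (rejection_time p g j \<omega>)" for j
      using that by (intro lag_rejection_time_cong assms) (auto simp: rejects_def)
    then show "F f k \<omega> = F g k \<omega>" by (simp add: F_def)
  qed
  then have "adm_wf less_than F" by (auto simp: adm_wf_def)
  then have "wfrec less_than F = F (wfrec less_than F)"
    by (intro wfrec_fixpoint) auto
  then obtain c where c: "c = F c" by blast
  have "c k \<omega> = F c k \<omega>" for k \<omega>
    by (rule fun_cong[OF fun_cong[OF c]])
  then have "LORD_procedure M p \<alpha> W0 \<gamma> c"
    unfolding LORD_procedure_def F_def by blast
  then show ?thesis by blast
qed

lemma LORD_procedure_online:
  assumes "spending_sequence \<gamma>" and L: "LORD_procedure M p \<alpha> W0 \<gamma> c"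
  shows "online_procedure M p c"
  unfolding online_procedure_def
proof
  fix k
  let ?G = "rejection_algebra M p c k"
  let ?gen = "{(\<lambda>\<omega>. of_bool (rejects p c i \<omega>) :: real) -` B \<inter> space M | i B. i \<in> {1..k} \<and> B \<in> sets borel}"
  have gen: "?gen \<subseteq> Pow (space M)" by auto
  have space: "space ?G = space M" and sets: "sets ?G = sigma_sets (space M) ?gen"
    unfolding rejection_algebra_def using gen by (simp_all add: space_measure_of sets_measure_of)
  have ind: "(\<lambda>\<omega>. of_bool (rejects p c i \<omega>) :: real) \<in> borel_measurable ?G" if "i \<in> {1..k}" for i
    using that by (intro measurableI) (auto simp: space sets intro!: sigma_sets.Basic)
  have rej: "{\<omega> \<in> space M. rejects p c i \<omega>} \<in> sets ?G" if "i \<in> {1..k}" for i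
  proof -
    have "(\<lambda>\<omega>. of_bool (rejects p c i \<omega>) :: real) -` {1} \<inter> space ?G \<in> sets ?G"
      by (intro measurable_sets[OF ind[OF that]]) simp
    then show ?thesis by (simp add: space vimage_def Int_def conj_commute)
  qed
  define S where "S = (\<lambda>\<omega>. {i \<in> {1..k}. rejects p c i \<omega>})"
  have S: "S \<in> measurable ?G (count_space (Pow {1..k}))"
  proof (rule measurable_count_space_eq2[THEN iffD2]; (intro conjI ballI)?)
    show "finite (Pow {1..k})" by simp
    show "S \<in> space ?G \<rightarrow> Pow {1..k}" by (auto simp: S_def)
    fix A assume A: "A \<in> Pow {1..k}"
    have "S \<omega> = A \<longleftrightarrow> (\<forall>i\<in>{1..k}. rejects p c i \<omega> \<longleftrightarrow> i \<in> A)" for \<omega>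
      using A unfolding S_def by blast
    then have "S -` {A} \<inter> space ?G =
        {\<omega> \<in> space ?G. \<forall>i\<in>{1..k}. rejects p c i \<omega> \<longleftrightarrow> i \<in> A}"
      by blast
    also have "\<dots> \<in> sets ?G"
    proof (intro sets.sets_Collect_finite_All)
      fix i assume i: "i \<in> {1..k}"
      show "{\<omega> \<in> space ?G. rejects p c i \<omega> \<longleftrightarrow> i \<in> A} \<in> sets ?G"
        using rej[OF i] sets.sets_Collect_neg[of ?G "rejects p c i"] by (cases "i \<in> A") (auto simp: space)
    qed auto
    finally show "S -` {A} \<inter> space ?G \<in> sets ?G" .
  qed
  have eq: "c (Suc k) \<omega> = c (Suc k) \<omega>'" if "\<omega> \<in> space M" "\<omega>' \<in> space M" "S \<omega> = S \<omega>'" for \<omega> \<omega>'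
  proof -
    have "rejects p c i \<omega> = rejects p c i \<omega>'" if "1 \<le> i" "i < Suc k" for i
    proof -
      have "i \<in> S \<omega> \<longleftrightarrow> i \<in> S \<omega>'" using \<open>S \<omega> = S \<omega>'\<close> by simp
      then show ?thesis using that by (simp add: S_def)
    qed
    then have "lag \<gamma> (Suc k) (rejection_time p c j \<omega>) = lag \<gamma> (Suc k) (rejection_time p c j \<omega>')" for j
      by (intro lag_rejection_time_cong assms) auto
    then show ?thesis
      using L that unfolding LORD_procedure_def by simp
  qed
  define h where "h = (\<lambda>A. c (Suc k) (SOME \<omega>. \<omega> \<in> space M \<and> S \<omega> = A))"
  have "c (Suc k) \<omega> = h (S \<omega>)" if "\<omega> \<in> space M" for \<omega>
  proof -
    have "(SOME \<omega>'. \<omega>' \<in> space M \<and> S \<omega>' = S \<omega>) \<in> space M \<and> S (SOME \<omega>'. \<omega>' \<in> space M \<and> S \<omega>' = S \<omega>) = S \<omega>"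
      by (rule someI[of _ \<omega>]) (simp add: that)
    then show ?thesis
      unfolding h_def using that by (intro eq) simp_all
  qed
  moreover have "(\<lambda>\<omega>. h (S \<omega>)) \<in> borel_measurable ?G"
    by (rule measurable_compose[OF S]) simp
  ultimately show "c (Suc k) \<in> borel_measurable ?G"
    using measurable_cong[of ?G "c (Suc k)" "\<lambda>\<omega>. h (S \<omega>)" borel] by (simp add: space)
qed

lemma KR_U_min_attained:
  assumes "0 < \<alpha>" "0 < \<delta>" "\<delta> < 1"
  shows "\<exists>a\<ge>1. (INF a\<in>{1..}. KR_U_term \<delta> \<alpha> r a) = KR_U_term \<delta> \<alpha> r a \<and>
           (\<forall>b\<ge>1. KR_U_term \<delta> \<alpha> r a \<le> KR_U_term \<delta> \<alpha> r b)"
proof -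
  let ?f = "KR_U_term \<delta> \<alpha> r"
  define m where "m = real (max 1 r)"
  have m: "m \<ge> 1" by (simp add: m_def)
  have lower: "real a / m \<le> ?f a" if "a \<ge> 1" for a
  proof -
    define L where "L = ln (1 / delta_at \<delta> a)"
    have "kappa > 1"
    proof -
      have "3\<^sup>2 < pi\<^sup>2" using pi_gt3 by (intro power_strict_mono) auto
      then show ?thesis by (simp add: kappa_def)
    qed
    moreover have "(real a)\<^sup>2 \<ge> 1" using that by simp
    ultimately have "kappa * (real a)\<^sup>2 > 1"
      by (smt (verit) mult_le_cancel_left1)
    then have "1 / delta_at \<delta> a > 1"
      using assms unfolding delta_at_def by (simp add: field_simps)
    then have L: "L > 0" unfolding L_def by (rule ln_gt_zero)
    have a: "real a > 0" using that by simp
    have "0 < ln (1 + L / real a)" "ln (1 + L / real a) \<le> L / real a"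
      using L a by (auto intro!: ln_add_one_self_le_self ln_gt_zero)
    then have "1 \<le> L / (real a * ln (1 + L / real a))"
      using a by (simp add: field_simps)
    moreover have "0 \<le> \<alpha> + real a / m" "real a / m \<le> \<alpha> + real a / m"
      using assms m by auto
    ultimately have "real a / m \<le> L / (real a * ln (1 + L / real a)) * (\<alpha> + real a / m)"
      by (smt (verit) mult_le_cancel_right1)
    then show ?thesis by (simp add: KR_U_term_def L_def m_def)
  qed
  define N where "N = nat \<lceil>m * ?f 1\<rceil> + 1"
  have big: "?f 1 \<le> ?f b" if "b > N" for b
  proof -
    have "m * ?f 1 \<le> real b" using that unfolding N_def by linarith
    then have "?f 1 \<le> real b / m" using m by (simp add: field_simps)
    also have "\<dots> \<le> ?f b" using that by (intro lower) auto
    finally show ?thesis .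
  qed
  have fin: "finite (?f ` {1..N})" and ne: "?f ` {1..N} \<noteq> {}" by (auto simp: N_def)
  obtain a where a: "a \<in> {1..N}" "?f a = Min (?f ` {1..N})"
    using Min_in[OF fin ne] by (metis imageE)
  have le: "?f a \<le> ?f b" if "b \<in> {1..N}" for b
    unfolding a(2) using that by (intro Min_le fin) auto
  have min: "?f a \<le> ?f b" if "b \<ge> 1" for b
  proof (cases "b \<le> N")
    case True then show ?thesis using le that by auto
  next
    case False
    have "?f a \<le> ?f 1" by (rule le) (auto simp: N_def)
    then show ?thesis using big[of b] False by auto
  qed
  have "(INF a\<in>{1..}. ?f a) = ?f a"
    by (rule cInf_eq_minimum) (use a(1) min in auto)
  with a(1) min show ?thesis by auto
qed

end

theory Submission
  imports Defs "HOL-Real_Asymp.Real_Asymp"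
begin

text \<open>
  Both envelopes are deterministic functions of \<open>R(k)\<close> whose limit superior in \<open>R(k)\<close> is at most
  \<open>\<alpha>\<close>, so \<open>{envelope - \<alpha> \<ge> \<epsilon>}\<close> is contained in \<open>{R(k) < N}\<close> for some fixed \<open>N\<close>, an event of
  vanishing probability. For the KR-U envelope, bound the minimum by the term at a fixed \<open>a\<close>; as
  \<open>R(k) \<rightarrow> \<infinity>\<close> it tends to \<open>\<alpha>\<close> times a factor that tends to 1 as \<open>a \<rightarrow> \<infinity>\<close>, because
  \<open>log(1/\<delta>\<^sub>a)/a \<rightarrow> 0\<close>.
\<close>

text \<open>Strong induction on time: \<open>c k\<close> is measurable for the algebra generated by
  the earlier rejection indicators, and by the induction hypothesis these generators are events of
  \<open>M\<close>, so that algebra lies inside \<open>M\<close>.\<close>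

lemma rejects_measurable:
  assumes p: "\<And>k. 1 \<le> k \<Longrightarrow> p k \<in> borel_measurable M"
    and c: "online_procedure M p c" and "1 \<le> k"
  shows "{\<omega> \<in> space M. rejects p c k \<omega>} \<in> sets M"
  using \<open>1 \<le> k\<close>
proof (induction k rule: less_induct)
  case (less k)
  then obtain n where k: "k = Suc n" by (cases k) auto
  let ?gen = "{(\<lambda>\<omega>. of_bool (rejects p c i \<omega>) :: real) -` B \<inter> space M | i B. i \<in> {1..n} \<and> B \<in> sets borel}"
  have "(\<lambda>\<omega>. of_bool (rejects p c i \<omega>) :: real) -` B \<inter> space M \<in> sets M"
    if "i \<in> {1..n}" "B \<in> sets borel" for i B
  proof -
    have [measurable]: "Measurable.pred M (rejects p c i)"
      using less.IH[of i] that k by (simp add: pred_def)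
    have "(\<lambda>\<omega>. of_bool (rejects p c i \<omega>) :: real) \<in> borel_measurable M"
      unfolding of_bool_def by measurable
    then show ?thesis using that(2) by (rule measurable_sets)
  qed
  then have "?gen \<subseteq> sets M" by blast
  then have "sets (rejection_algebra M p c n) \<subseteq> sets M"
    unfolding rejection_algebra_def
    by (subst sets_measure_of) (auto intro!: sets.sigma_sets_subset)
  moreover have "space (rejection_algebra M p c n) = space M"
    unfolding rejection_algebra_def by (rule space_measure_of) auto
  ultimately have "borel_measurable (rejection_algebra M p c n) \<subseteq> borel_measurable M"
    by (intro measurable_mono) auto
  then have [measurable]: "c k \<in> borel_measurable M"
    using c by (auto simp: online_procedure_def k)
  have [measurable]: "p k \<in> borel_measurable M" using p less.prems by blast
  show ?case unfolding rejects_def by measurable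
qed

lemma num_rejections_measurable:
  assumes "\<And>k. 1 \<le> k \<Longrightarrow> p k \<in> borel_measurable M" and "online_procedure M p c"
  shows "num_rejections p c k \<in> measurable M (count_space UNIV)"
proof -
  have "(\<lambda>\<omega>. of_bool (rejects p c i \<omega>) :: nat) \<in> measurable M (count_space UNIV)"
    if "i \<in> {1..k}" for i
  proof -
    have [measurable]: "Measurable.pred M (rejects p c i)"
      using rejects_measurable[OF assms, of i] that by (simp add: pred_def)
    show ?thesis unfolding of_bool_def by measurable
  qed
  then have "(\<lambda>\<omega>. \<Sum>i=1..k. of_bool (rejects p c i \<omega>) :: nat) \<in> measurable M (count_space UNIV)"
    by (rule measurable_sum_nat)
  then show ?thesis by (simp add: num_rejections_def[abs_def])
qed

text \<open>Carries a deterministic bound over to probability. An eventual upper bound on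
  \<open>f\<close> suffices because \<open>m_consistent\<close> is one-sided.\<close>

lemma m_consistent_of_inverse_o_P_one:
  assumes "finite_measure M"
    and R: "\<And>k. R k \<in> measurable M (count_space (UNIV :: nat set))"
    and o: "o_P_one M (\<lambda>k \<omega>. 1 / of_nat (R k \<omega>))"
    and f: "\<And>\<epsilon>. \<epsilon> > 0 \<Longrightarrow> \<forall>\<^sub>F r in sequentially. f r < \<alpha> + \<epsilon>"
  shows "m_consistent M \<alpha> (\<lambda>k \<omega>. f (R k \<omega>))"
  unfolding m_consistent_def
proof (intro allI impI)
  interpret finite_measure M by fact
  fix \<epsilon> :: real assume "\<epsilon> > 0"
  then obtain N0 where N0: "\<And>r. r \<ge> N0 \<Longrightarrow> f r < \<alpha> + \<epsilon>"
    using f by (auto simp: eventually_sequentially)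
  \<comment> \<open>The maximum keeps the threshold \<open>1 / real N\<close> positive, as
    \<open>o_P_one\<close> demands.\<close>
  define N where "N = max 1 N0"
  let ?B = "\<lambda>k. {\<omega> \<in> space M. 1 / of_nat (R k \<omega>) > ennreal (1 / real N)}"
  have lim: "(\<lambda>k. measure M (?B k)) \<longlonglongrightarrow> 0"
    using o unfolding o_P_one_def by (auto simp: N_def)
  have sub: "{\<omega> \<in> space M. f (R k \<omega>) - \<alpha> \<ge> \<epsilon>} \<subseteq> ?B k" for k
  proof
    fix \<omega> assume \<omega>: "\<omega> \<in> {\<omega> \<in> space M. f (R k \<omega>) - \<alpha> \<ge> \<epsilon>}"
    then have lt: "R k \<omega> < N"
      using N0[of "R k \<omega>"] by (cases "N0 \<le> R k \<omega>") (auto simp: N_def)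
    have "ennreal (1 / real N) < 1 / of_nat (R k \<omega>)"
    proof (cases "R k \<omega> = 0")
      \<comment> \<open>In \<open>ennreal\<close> the quotient \<open>1 / 0\<close> is infinite, so
        having no rejections puts the outcome in \<open>?B k\<close>.\<close>
      case True
      then show ?thesis by (simp add: ennreal_divide_zero)
    next
      case False
      then have "1 / of_nat (R k \<omega>) = ennreal (1 / real (R k \<omega>))"
        by (simp add: divide_ennreal[symmetric] ennreal_of_nat_eq_real_of_nat)
      moreover have "1 / real N < 1 / real (R k \<omega>)"
        using False lt by (simp add: frac_less2)
      ultimately show ?thesis by (simp add: ennreal_less_iff del: divide_const_simps)
    qed
    with \<omega> show "\<omega> \<in> ?B k" by simp
  qed
  \<comment> \<open>Monotonicity of the measure asks for measurability of the larger event.\<close>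
  have meas: "?B k \<in> sets M" for k
  proof -
    have "(\<lambda>\<omega>. 1 / of_nat (R k \<omega>) :: ennreal) \<in> borel_measurable M"
      by (rule measurable_compose[OF R]) simp
    then show ?thesis by measurable
  qed
  show "(\<lambda>k. measure M {\<omega> \<in> space M. f (R k \<omega>) - \<alpha> \<ge> \<epsilon>}) \<longlonglongrightarrow> 0"
    by (rule tendsto_sandwich[OF _ _ tendsto_const lim])
      (auto intro!: always_eventually finite_measure_mono sub meas)
qed

lemma kappa_pos: "kappa > 0"
  by (simp add: kappa_def)

text \<open>\<open>eps_at\<close> grows like log log, so the numerator is only of order sqrt(r log
  log r).\<close>

lemma Delta_sublinear:
  assumes "0 < \<alpha>"
  shows "(\<lambda>r. Delta \<delta> (\<alpha> * real r) / real r) \<longlonglongrightarrow> 0"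
proof -
  define C where "C = ln ((1 + kappa) / \<delta>)"
  have "((\<lambda>x. (2 * sqrt (C + 2 * ln (1 + log 2 (\<alpha> * x))) * sqrt (\<alpha> * x)
              + (C + 2 * ln (1 + log 2 (\<alpha> * x))) / 2) / x) \<longlongrightarrow> 0) at_top"
    using assms by real_asymp
  then have lim: "(\<lambda>r. (2 * sqrt (C + 2 * ln (1 + log 2 (\<alpha> * real r))) * sqrt (\<alpha> * real r)
              + (C + 2 * ln (1 + log 2 (\<alpha> * real r))) / 2) / real r) \<longlonglongrightarrow> 0"
    by (rule filterlim_compose[OF _ filterlim_real_sequentially])
  \<comment> \<open>From here on the truncations \<open>max u 1\<close> inside \<open>Delta\<close>
    disappear and the closed form above is exact.\<close>
  have "\<forall>\<^sub>F r in sequentially. \<alpha> * real r \<ge> 1"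
    using assms by real_asymp
  then show ?thesis
    by (intro Lim_transform_eventually[OF lim])
      (auto elim!: eventually_mono simp: Delta_def eps_at_def C_def max_absorb1)
qed

lemma FDP_Freed_eventually_less:
  assumes "0 < \<alpha>" "\<epsilon> > 0"
  shows "\<forall>\<^sub>F r in sequentially. FDP_Freed \<delta> \<alpha> r < \<alpha> + \<epsilon>"
proof -
  have "\<forall>\<^sub>F r in sequentially. Delta \<delta> (\<alpha> * real r) / real r < \<epsilon>"
    using order_tendstoD(2)[OF Delta_sublinear[OF assms(1)] assms(2)] .
  \<comment> \<open>For \<open>r\<close> at least 1 the maximum with 1 is \<open>r\<close> itself,
    and the cap at 1 can only lower the envelope.\<close>
  then show ?thesis
    using eventually_ge_at_top[of 1]
    by eventually_elim (auto simp: FDP_Freed_def max_absorb2)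
qed

text \<open>With x = log(1/\<delta>_a)/a the factor is x / log(1 + x). Here 1/\<delta>_a is
  quadratic in a, so x tends to 0 and the ratio to 1.\<close>

lemma KR_U_factor_tendsto_1:
  assumes "0 < \<delta>"
  shows "(\<lambda>a. ln (1 / delta_at \<delta> a) / (real a * ln (1 + ln (1 / delta_at \<delta> a) / real a))) \<longlonglongrightarrow> 1"
proof -
  define K where "K = kappa / \<delta>"
  have "K > 0" using assms kappa_pos by (simp add: K_def)
  then have "((\<lambda>x. ln (K * x\<^sup>2) / (x * ln (1 + ln (K * x\<^sup>2) / x))) \<longlongrightarrow> 1) at_top"
    by real_asymp
  from filterlim_compose[OF this filterlim_real_sequentially] show ?thesis
    by (simp add: delta_at_def K_def)
qed

lemma FDP_KR_U_eventually_less: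
  assumes "0 < \<alpha>" "0 < \<delta>" "\<delta> < 1" "\<epsilon> > 0"
  shows "\<forall>\<^sub>F r in sequentially. FDP_KR_U \<delta> \<alpha> r < \<alpha> + \<epsilon>"
proof -
  define C where "C a = ln (1 / delta_at \<delta> a) / (real a * ln (1 + ln (1 / delta_at \<delta> a) / real a))" for a
  have "(\<lambda>a. C a * \<alpha>) \<longlonglongrightarrow> 1 * \<alpha>"
    unfolding C_def by (intro tendsto_mult KR_U_factor_tendsto_1 assms tendsto_const)
  then have "\<forall>\<^sub>F a in sequentially. C a * \<alpha> < \<alpha> + \<epsilon>"
    by (rule order_tendstoD) (use assms in simp)
  then have "\<forall>\<^sub>F a in sequentially. C a * \<alpha> < \<alpha> + \<epsilon> \<and> 1 \<le> a"
    using eventually_ge_at_top[of 1] by eventually_elim simp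
  \<comment> \<open>This \<open>a\<close> is fixed before \<open>r\<close> varies; the strict
    inequality leaves the room that absorbs \<open>real a / real r\<close> for large
    \<open>r\<close>.\<close>
  then obtain a where a: "C a * \<alpha> < \<alpha> + \<epsilon>" "1 \<le> a"
    by (auto dest: eventually_happens)
  have "(\<lambda>r. C a * (\<alpha> + real a / real r)) \<longlonglongrightarrow> C a * (\<alpha> + 0)"
    by (intro tendsto_intros lim_const_over_n)
  then have "\<forall>\<^sub>F r in sequentially. C a * (\<alpha> + real a / real r) < \<alpha> + \<epsilon>"
    by (rule order_tendstoD) (use a in simp)
  then show ?thesis
    using eventually_ge_at_top[of 1]
  proof eventually_elim
    case (elim r)
    \<comment> \<open>That the minimum is attained ensures that the real-valued infimum lies below
      every term.\<close>
    have "FDP_KR_U \<delta> \<alpha> r \<le> KR_U_term \<delta> \<alpha> r a"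
      using KR_U_min_attained[OF assms(1-3), of r] a(2) by (auto simp: FDP_KR_U_def min.coboundedI2)
    also have "\<dots> = C a * (\<alpha> + real a / real r)"
      using elim by (simp add: KR_U_term_def C_def max_absorb2)
    finally show ?case using elim by simp
  qed
qed

theorem proposition30:
  fixes M :: "'a measure"
    and p c :: "nat \<Rightarrow> 'a \<Rightarrow> real"
    and H0 :: "nat set"
    and \<gamma> :: "int \<Rightarrow> real"
    and \<alpha> \<delta> W0 :: real
  assumes "prob_space M"
    and "0 < \<alpha>" "\<alpha> < 1" and "0 < \<delta>" "\<delta> < 1"
    and "\<And>k. 1 \<le> k \<Longrightarrow> p k \<in> borel_measurable M"
    and "\<And>k \<omega>. 1 \<le> k \<Longrightarrow> \<omega> \<in> space M \<Longrightarrow> p k \<omega> \<in> {0..1}"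
    and "H0 \<subseteq> {1..}"
    and "W0 \<in> {0..\<alpha>}"
    and "spending_sequence \<gamma>"
    and "online_procedure M p c"
    and "LORD_procedure M p \<alpha> W0 \<gamma> c"
    and "cond_super_uniform M p c H0"
    and "o_P_one M (\<lambda>k \<omega>. 1 / of_nat (num_rejections p c k \<omega>))"
  shows "m_consistent M \<alpha> (\<lambda>k \<omega>. FDP_Freed \<delta> \<alpha> (num_rejections p c k \<omega>)) \<and>
         m_consistent M \<alpha> (\<lambda>k \<omega>. FDP_KR_U \<delta> \<alpha> (num_rejections p c k \<omega>))"
proof -
  interpret prob_space M by fact
  \<comment> \<open>Takes \<open>R\<close> to be the rejection count; only the eventual bound on
    each envelope is left to supply.\<close>
  note consistent = m_consistent_of_inverse_o_P_one[OF finite_measure_axioms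
      num_rejections_measurable[OF assms(6,11)] assms(14)]
  show ?thesis
    by (intro conjI consistent FDP_Freed_eventually_less FDP_KR_U_eventually_less assms)
qed

end
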